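(* Let $\varphi=\frac{1+\sqrt5}{2}$. There are exactly two non-trivial increasing solutions to the complementary pair problem for $\alpha=\varphi$, normalized by $V(1)=1$. That is, among all sextuples of integers $(p,q,r,s,t,u)$ with $p\neq 0$ and $s\neq 0$, the sequences $V(n)=p\lfloor n\varphi\rfloor+qn+r$ and $W(n)=s\lfloor n\varphi\rfloor+tn+u$ ($n\ge 1$) are increasing, complementary and satisfy $V(1)=1$ if and only if $$(p,q,r,s,t,u)=(1,0,0,1,1,0)\quad\text{or}\quad (p,q,r,s,t,u)=(-1,3,-1,1,2,0).$$
   Context: Two sequences $V=(V(n))_{n\ge1}$, $W=(W(n))_{n\ge1}$ of positive integers are complementary if the sets $\{V(n):n\ge1\}$ and $\{W(n):n\ge1\}$ are disjoint and their union is the set of positive integers. The complementary pair problem for $\alpha$ asks for all sextuples of integers $(p,q,r,s,t,u)$ such that $V(n)=p\lfloor n\alpha\rfloor+qn+r$ and $W(n)=s\lfloor n\alpha\rfloor+tn+u$ ($n\ge 1$) are complementary. Sequences are required to be injective, so "increasing" means strictly increasing. A solution is trivial if $p=0$ or $s=0$. When $V$ and $W$ are increasing, one normalizes (by ordering the pair) so that $V(1)=1$. *)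

theory Defs
  imports Complex_Main
begin

text \<open>Sequences indexed by the integers \<open>n \<ge> 1\<close> are functions on \<^typ>\<open>nat\<close> whose value at 0 is
  irrelevant: every notion below only looks at the indices in \<^term>\<open>{1::nat..}\<close>.\<close>

definition gen_beatty :: "real \<Rightarrow> int \<Rightarrow> int \<Rightarrow> int \<Rightarrow> nat \<Rightarrow> int" where
  "gen_beatty \<alpha> p q r n = p * \<lfloor>real n * \<alpha>\<rfloor> + q * int n + r"

text \<open>Positivity of the terms is part of the last conjunct.\<close>

definition complementary :: "(nat \<Rightarrow> int) \<Rightarrow> (nat \<Rightarrow> int) \<Rightarrow> bool" where
  "complementary V W \<longleftrightarrow>
     inj_on V {1..} \<and> inj_on W {1..} \<and>
     V ` {1..} \<inter> W ` {1..} = {} \<and>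
     V ` {1..} \<union> W ` {1..} = {k. k > 0}"

definition comp_pair_solution :: "real \<Rightarrow> int \<times> int \<times> int \<times> int \<times> int \<times> int \<Rightarrow> bool" where
  "comp_pair_solution \<alpha> = (\<lambda>(p, q, r, s, t, u).
     complementary (gen_beatty \<alpha> p q r) (gen_beatty \<alpha> s t u))"

definition trivial_solution :: "int \<times> int \<times> int \<times> int \<times> int \<times> int \<Rightarrow> bool" where
  "trivial_solution = (\<lambda>(p, q, r, s, t, u). p = 0 \<or> s = 0)"

definition increasing_solution :: "real \<Rightarrow> int \<times> int \<times> int \<times> int \<times> int \<times> int \<Rightarrow> bool" where
  "increasing_solution \<alpha> = (\<lambda>(p, q, r, s, t, u).
     comp_pair_solution \<alpha> (p, q, r, s, t, u) \<and>
     strict_mono_on {1..} (gen_beatty \<alpha> p q r) \<and>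
     strict_mono_on {1..} (gen_beatty \<alpha> s t u))"

definition golden_ratio :: real where
  "golden_ratio = (1 + sqrt 5) / 2"

end

(* Complementary sequences of linear growth rates x, y > 0 satisfy 1/x + 1/y = 1, as one sees by
   counting the terms up to N. Here x = p \<phi> + q and y = s \<phi> + t, and comparing the coefficients
   of 1 and \<phi> in x y = x + y gives two integer equations. Strict monotonicity says that the gaps
   p + q, 2 p + q, s + t, 2 s + t are all at least 1, and in terms of the gaps minus one the equations
   are a bilinear system in nonnegative integers with just four non-trivial solutions. The
   normalization V(1) = 1 then determines r and u, and discards the two solutions with V and W
   swapped. Conversely, both remaining pairs are classical Beatty pairs
   (the second one is n (3 - \<phi>), n (\<phi> + 2)). *)

theory Submission
  imports Defs
begin

section \<open>Growth rates of complementary sequences\<close>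

text \<open>By monotonicity the counted indices form an initial segment \<open>{1..v}\<close>; the
  linear bound at \<open>v\<close> and at \<open>v + 1\<close> keeps \<open>x * v\<close> within a
  bounded distance of \<open>N\<close>.\<close>

lemma card_le_of_linear_growth:
  fixes f :: "nat \<Rightarrow> int" and x c :: real
  assumes mono: "strict_mono_on {1..} f"
    and pos: "\<And>n. n \<ge> 1 \<Longrightarrow> f n > 0"
    and x: "x > 0"
    and lin: "\<And>n. n \<ge> 1 \<Longrightarrow> \<bar>of_int (f n) - x * real n\<bar> \<le> c"
  shows "finite {n. n \<ge> 1 \<and> f n \<le> int N}"
    and "\<bar>real (card {n. n \<ge> 1 \<and> f n \<le> int N}) - real N / x\<bar> \<le> c / x + 1"
proof -
  let ?S = "{n. n \<ge> 1 \<and> f n \<le> int N}"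
  have c0: "c \<ge> 0" using lin[of 1] by simp
  have less: "f m < f n" if "1 \<le> m" "m < n" for m n
    using strict_mono_onD[OF mono, of m n] that by auto
  have ge: "f (Suc n) \<ge> int (Suc n)" for n
  proof (induction n)
    case 0
    show ?case using pos[of 1] by simp
  next
    case (Suc n)
    then show ?case using less[of "Suc n" "Suc (Suc n)"] by simp
  qed
  have sub: "?S \<subseteq> {1..N}"
  proof
    fix n assume "n \<in> ?S"
    then show "n \<in> {1..N}" using ge[of "n - 1"] by auto
  qed
  then show fin: "finite ?S" by (rule finite_subset) simp
  \<comment> \<open>The default 0 makes \<open>?S = {1..v}\<close> hold for empty \<open>?S\<close>
    as well.\<close>
  define v where "v = (if ?S = {} then 0 else Max ?S)"
  have S: "?S = {1..v}"
  proof (cases "?S = {}")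
    case True
    then show ?thesis by (auto simp: v_def)
  next
    case False
    then have v: "v = Max ?S" by (simp only: v_def if_False)
    have vS: "v \<in> ?S" unfolding v using Max_in[OF fin False] .
    show ?thesis
    proof (intro equalityI subsetI)
      fix n assume "n \<in> ?S"
      then show "n \<in> {1..v}" using Max_ge[OF fin, of n] v by auto
    next
      fix n assume n: "n \<in> {1..v}"
      then have "f n \<le> f v" using less[of n v] by (cases "n = v") auto
      then show "n \<in> ?S" using n vS by auto
    qed
  qed
  have lower: "x * real v - c \<le> real N"
  proof (cases "v = 0")
    case True
    then show ?thesis using c0 by simp
  next
    case False
    then have "v \<in> ?S" unfolding S by simp
    then have "real_of_int (f v) \<le> real N" by (simp add: of_int_le_iff [symmetric])
    then show ?thesis using lin[of v] False by (simp add: abs_le_iff)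
  qed
  have "Suc v \<notin> ?S" unfolding S by simp
  then have "real N < real_of_int (f (Suc v))" by simp
  then have upper: "real N \<le> x * real v + x + c"
    using lin[of "Suc v"] by (simp add: abs_le_iff algebra_simps)
  have "real v \<le> (real N + c) / x" "(real N - c) / x \<le> real v + 1"
    using lower upper x by (simp_all add: pos_le_divide_eq pos_divide_le_eq algebra_simps)
  then have "real v - real N / x \<le> c / x" "real N / x - real v \<le> c / x + 1"
    by (simp_all add: add_divide_distrib diff_divide_distrib)
  then have "\<bar>real v - real N / x\<bar> \<le> c / x + 1"
    using c0 x by (auto simp: abs_le_iff intro: order_trans)
  then show "\<bar>real (card ?S) - real N / x\<bar> \<le> c / x + 1" unfolding S by simp
qed

text \<open>Sorting the integers in \<open>{1..N}\<close> by the sequence they belong to gives N =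
  N/x + N/y + O(1). Hence all multiples of |1 - 1/x - 1/y| stay below one constant, which forces
  this number to be 0.\<close>

lemma complementary_growth_rates:
  fixes V W :: "nat \<Rightarrow> int" and x y c d :: real
  assumes comp: "complementary V W"
    and mono: "strict_mono_on {1..} V" "strict_mono_on {1..} W"
    and pos: "x > 0" "y > 0"
    and lin: "\<And>n. n \<ge> 1 \<Longrightarrow> \<bar>of_int (V n) - x * real n\<bar> \<le> c"
      "\<And>n. n \<ge> 1 \<Longrightarrow> \<bar>of_int (W n) - y * real n\<bar> \<le> d"
  shows "1 / x + 1 / y = 1"
proof (rule ccontr)
  assume neq: "1 / x + 1 / y \<noteq> 1"
  define e where "e = \<bar>1 - 1 / x - 1 / y\<bar>"
  have un: "V ` {1..} \<union> W ` {1..} = {k. k > 0}" and dis: "V ` {1..} \<inter> W ` {1..} = {}"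
    and inj: "inj_on V {1..}" "inj_on W {1..}"
    using comp by (auto simp: complementary_def)
  have Vpos: "V n > 0" and Wpos: "W n > 0" if "n \<ge> 1" for n
    using that un by (auto simp: set_eq_iff)
  have bound: "real N * e \<le> c / x + 1 + (d / y + 1)" for N
  proof -
    let ?S = "{n. n \<ge> 1 \<and> V n \<le> int N}" and ?T = "{n. n \<ge> 1 \<and> W n \<le> int N}"
    note V = card_le_of_linear_growth[OF mono(1) Vpos pos(1) lin(1), of N]
    note W = card_le_of_linear_growth[OF mono(2) Wpos pos(2) lin(2), of N]
    have split: "V ` ?S \<union> W ` ?T = {1..int N}"
    proof (intro equalityI subsetI)
      fix k assume "k \<in> {1..int N}"
      moreover from this have "k \<in> V ` {1..} \<union> W ` {1..}" unfolding un by simp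
      ultimately show "k \<in> V ` ?S \<union> W ` ?T" by auto
    next
      fix k assume "k \<in> V ` ?S \<union> W ` ?T"
      then show "k \<in> {1..int N}" using Vpos Wpos by fastforce
    qed
    have "card (V ` ?S \<union> W ` ?T) = card (V ` ?S) + card (W ` ?T)"
      using V(1) W(1) dis by (intro card_Un_disjoint) auto
    also have "card (V ` ?S) = card ?S" by (rule card_image, rule inj_on_subset[OF inj(1)]) auto
    also have "card (W ` ?T) = card ?T" by (rule card_image, rule inj_on_subset[OF inj(2)]) auto
    finally have "real (card ?S) + real (card ?T) = real N" unfolding split by simp
    then have "\<bar>real N - real N / x - real N / y\<bar> \<le> c / x + 1 + (d / y + 1)"
      using V(2) W(2) by linarith
    moreover have "real N - real N / x - real N / y = real N * (1 - 1 / x - 1 / y)"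
      by (simp add: algebra_simps)
    ultimately show ?thesis by (simp add: e_def abs_mult)
  qed
  have "e > 0" using neq by (simp add: e_def)
  from reals_Archimedean3[OF this] bound show False by (meson not_le)
qed

section \<open>Beatty's theorem\<close>

text \<open>An irrational number is no integer, so the lower inequality is strict; Beatty's theorem
  relies on strict bounds on both sides.\<close>

lemma floor_eq_iff_irrational:
  fixes a :: real
  assumes "a \<notin> \<rat>"
  shows "\<lfloor>a\<rfloor> = k \<longleftrightarrow> of_int k < a \<and> a < of_int k + 1"
  using assms Rats_of_int[of k] by (auto simp: floor_eq_iff less_le)

text \<open>If \<open>k\<close> were hit by both sequences or by neither, the resulting bounds on
  the quotients of \<open>k\<close> and \<open>k + 1\<close> by \<open>a\<close> and
  \<open>b\<close>, added by means of \<open>1 / a + 1 / b = 1\<close>, would put an integer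
  strictly between two consecutive integers.\<close>

lemma beatty_complementary:
  fixes a b :: real
  assumes pos: "a > 0" "b > 0" and sum: "1 / a + 1 / b = 1" and irr: "a \<notin> \<rat>" "b \<notin> \<rat>"
  shows "complementary (\<lambda>n. \<lfloor>real n * a\<rfloor>) (\<lambda>n. \<lfloor>real n * b\<rfloor>)"
    and "strict_mono_on {1..} (\<lambda>n. \<lfloor>real n * a\<rfloor>)"
    and "strict_mono_on {1..} (\<lambda>n. \<lfloor>real n * b\<rfloor>)"
proof -
  \<comment> \<open>Slopes above 1 give strict monotonicity and positive terms.\<close>
  have gt1: "c > 1" if "c > 0" "d > 0" "1 / c + 1 / d = 1" for c d :: real
  proof -
    have "1 / c < 1" using that by (smt (verit) zero_less_divide_1_iff)
    then show ?thesis using that by simp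
  qed
  have irr': "real n * c \<notin> \<rat>" if "c \<notin> \<rat>" "n \<ge> 1" for n and c :: real
  proof
    assume "real n * c \<in> \<rat>"
    then have "real n * c / real n \<in> \<rat>" by (intro Rats_divide) auto
    then show False using that by simp
  qed
  have mono: "strict_mono_on {1..} (\<lambda>n. \<lfloor>real n * c\<rfloor>)" if "c > 1" for c :: real
  proof (rule strict_mono_onI)
    fix m n :: nat assume "m < n"
    then have "real m + 1 \<le> real n" by simp
    then have "(real m + 1) * c \<le> real n * c" using that by (intro mult_right_mono) auto
    then have "real m * c + 1 \<le> real n * c" using that by (simp add: algebra_simps)
    then show "\<lfloor>real m * c\<rfloor> < \<lfloor>real n * c\<rfloor>" by linarith
  qed
  have pos': "\<lfloor>real n * c\<rfloor> > 0" if "c > 1" "n \<ge> 1" for n and c :: real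
    using mult_mono[of 1 "real n" 1 c] that by simp
  have a1: "a > 1" and b1: "b > 1"
    using gt1[of a b] gt1[of b a] pos sum by (auto simp: add.commute)
  show monoa: "strict_mono_on {1..} (\<lambda>n. \<lfloor>real n * a\<rfloor>)"
    and monob: "strict_mono_on {1..} (\<lambda>n. \<lfloor>real n * b\<rfloor>)"
    using mono[OF a1] mono[OF b1] .
  have split: "z / a + z / b = z" for z
    using arg_cong[OF sum, of "\<lambda>w. z * w"] by (simp add: distrib_left)
  have disjoint: "\<lfloor>real n * a\<rfloor> \<noteq> \<lfloor>real m * b\<rfloor>" if nm: "n \<ge> 1" "m \<ge> 1" for n m
  proof
    assume eq: "\<lfloor>real n * a\<rfloor> = \<lfloor>real m * b\<rfloor>"
    define k where "k = \<lfloor>real n * a\<rfloor>"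
    have "real_of_int k < real n * a" "real n * a < real_of_int k + 1"
      "real_of_int k < real m * b" "real m * b < real_of_int k + 1"
      using floor_eq_iff_irrational[of "real n * a" k] floor_eq_iff_irrational[of "real m * b" k]
        irr'[OF irr(1) nm(1)] irr'[OF irr(2) nm(2)] eq by (auto simp: k_def)
    then have "real_of_int k / a < real n" "real n < (real_of_int k + 1) / a"
      "real_of_int k / b < real m" "real m < (real_of_int k + 1) / b"
      using pos by (simp_all add: field_simps)
    then have "real_of_int k < real_of_int (int (n + m))"
      "real_of_int (int (n + m)) < real_of_int (k + 1)"
      using split[of "real_of_int k"] split[of "real_of_int k + 1"] by simp_all
    then show False unfolding of_int_less_iff by linarith
  qed
  \<comment> \<open>For a skipped \<open>k\<close>, both \<open>k\<close> and \<open>k + 1\<close>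
    lie strictly between consecutive multiples \<open>n * c\<close> and \<open>(n + 1) * c\<close>;
    here \<open>n\<close> may be 0.\<close>
  have gap: "\<exists>n::nat. real n < real_of_int k / c \<and> (real_of_int k + 1) / c < real n + 1"
    if "c > 0" "c \<notin> \<rat>" "k > 0" "k \<notin> (\<lambda>n. \<lfloor>real n * c\<rfloor>) ` {1..}" for k and c :: real
  proof -
    define n where "n = nat \<lfloor>real_of_int k / c\<rfloor>"
    have kc: "real_of_int k / c > 0" using that by simp
    then have n: "real n \<le> real_of_int k / c" "real_of_int k / c < real n + 1"
      unfolding n_def by linarith+
    have "real n \<noteq> real_of_int k / c"
    proof
      assume eq: "real n = real_of_int k / c"
      then have "real n * c = real_of_int k" using that by simp
      moreover have "n \<ge> 1" using eq kc by (cases n) auto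
      ultimately show False using irr'[OF that(2), of n] by simp
    qed
    \<comment> \<open>If \<open>(n + 1) * c \<le> k + 1\<close>, irrationality excludes equality, so
      the floor of \<open>(n + 1) * c\<close> is \<open>k\<close> and \<open>k\<close> is not
      skipped.\<close>
    moreover have "(real_of_int k + 1) / c < real n + 1"
    proof (rule ccontr)
      assume "\<not> ?thesis"
      then have le: "real (Suc n) * c \<le> real_of_int k + 1" using that by (simp add: field_simps)
      have neq: "real (Suc n) * c \<noteq> real_of_int k + 1"
        using irr'[OF that(2), of "Suc n"] Rats_of_int[of "k + 1", where ?'a = real]
        by (auto simp del: Rats_of_int)
      have "real_of_int k < real (Suc n) * c" using n that by (simp add: field_simps)
      with le neq have "\<lfloor>real (Suc n) * c\<rfloor> = k" by (intro floor_unique) linarith+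
      then have "k = \<lfloor>real (Suc n) * c\<rfloor>" by (rule sym)
      moreover have "Suc n \<in> {1..}" by simp
      ultimately show False using that(4) by blast
    qed
    ultimately show ?thesis using n by (intro exI[of _ n]) linarith
  qed
  have cover: "k \<in> (\<lambda>n. \<lfloor>real n * a\<rfloor>) ` {1..} \<union> (\<lambda>n. \<lfloor>real n * b\<rfloor>) ` {1..}" if k: "k > 0" for k
  proof (rule ccontr)
    assume "\<not> ?thesis"
    then obtain n m :: nat
      where "real n < real_of_int k / a" "(real_of_int k + 1) / a < real n + 1"
        "real m < real_of_int k / b" "(real_of_int k + 1) / b < real m + 1"
      using gap[OF pos(1) irr(1) k] gap[OF pos(2) irr(2) k] by blast
    \<comment> \<open>The second bound comes from \<open>k + 1 < (n + 1) + (m + 1)\<close>.\<close>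
    then have "real_of_int (int (n + m)) < real_of_int k"
      "real_of_int k < real_of_int (int (n + m + 1))"
      using split[of "real_of_int k"] split[of "real_of_int k + 1"] by simp_all
    then show False unfolding of_int_less_iff by linarith
  qed
  show "complementary (\<lambda>n. \<lfloor>real n * a\<rfloor>) (\<lambda>n. \<lfloor>real n * b\<rfloor>)"
    unfolding complementary_def
  proof (intro conjI)
    show "(\<lambda>n. \<lfloor>real n * a\<rfloor>) ` {1..} \<inter> (\<lambda>n. \<lfloor>real n * b\<rfloor>) ` {1..} = {}"
      using disjoint by auto
    show "(\<lambda>n. \<lfloor>real n * a\<rfloor>) ` {1..} \<union> (\<lambda>n. \<lfloor>real n * b\<rfloor>) ` {1..} = {k. k > 0}"
      using cover pos'[OF a1] pos'[OF b1] by blast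
  qed (rule strict_mono_on_imp_inj_on[OF monoa] strict_mono_on_imp_inj_on[OF monob])+
qed

section \<open>The golden ratio\<close>

lemma golden_ratio_sq: "golden_ratio * golden_ratio = golden_ratio + 1"
proof -
  have "sqrt 5 * sqrt 5 = (5::real)" by simp
  then show ?thesis unfolding golden_ratio_def by (simp add: field_simps)
qed

text \<open>Sharp enough to fix the floors of \<phi>, 2 \<phi> and 3 \<phi>.\<close>

lemma golden_ratio_bounds: "161 / 100 < golden_ratio" "golden_ratio < 162 / 100"
proof -
  have "222 / 100 < sqrt 5" "sqrt 5 < 224 / 100"
    by (rule real_less_rsqrt real_less_lsqrt; simp add: power2_eq_square)+
  then show "161 / 100 < golden_ratio" "golden_ratio < 162 / 100"
    by (simp_all add: golden_ratio_def)
qed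

(* Infinite descent: b^2 + a b - a^2 is odd unless a and b are both even. *)
lemma golden_norm_eq_0:
  fixes a b :: int
  assumes "b * b + a * b = a * a"
  shows "a = 0"
  using assms
proof (induction "nat \<bar>a\<bar>" arbitrary: a b rule: less_induct)
  case less
  have "even (b * b + a * b) = even (a * a)" using less.prems by simp
  then have "even a" "even b" by auto
  then obtain a' b' where a: "a = 2 * a'" and b: "b = 2 * b'" by (auto elim!: evenE)
  show "a = 0"
  proof (rule ccontr)
    assume "a \<noteq> 0"
    then have "nat \<bar>a'\<bar> < nat \<bar>a\<bar>" using a by auto
    moreover have "b' * b' + a' * b' = a' * a'" using less.prems a b by simp
    ultimately have "a' = 0" by (rule less.hyps)
    then show False using a \<open>a \<noteq> 0\<close> by simp
  qed
qed

text \<open>Linear independence of 1 and \<phi> over the integers: substituting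
  \<open>b = - a * golden_ratio\<close> and using \<phi>^2 = \<phi> + 1 makes the norm form b^2 + a
  b - a^2 vanish.\<close>

lemma golden_lin_eq_0:
  fixes a b :: int
  assumes "of_int a * golden_ratio + of_int b = 0"
  shows "a = 0" "b = 0"
proof -
  have b: "real_of_int b = - (of_int a * golden_ratio)" using assms by linarith
  have "real_of_int (b * b + a * b)
      = of_int a * of_int a * (golden_ratio * golden_ratio - golden_ratio)"
    by (simp add: b algebra_simps)
  also have "\<dots> = real_of_int (a * a)" by (simp add: golden_ratio_sq)
  finally have "b * b + a * b = a * a" by (simp only: of_int_eq_iff)
  then show "a = 0" by (rule golden_norm_eq_0)
  then show "b = 0" using assms by simp
qed

lemma golden_ratio_irrational: "golden_ratio \<notin> \<rat>"
proof
  assume "golden_ratio \<in> \<rat>"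
  then obtain a b :: int where b: "b > 0" and "golden_ratio = of_int a / of_int b"
    by (auto elim: Rats_cases')
  then have "of_int b * golden_ratio + of_int (- a) = 0" by (simp add: nonzero_eq_divide_eq mult.commute)
  then show False using golden_lin_eq_0(1)[of b "- a"] b by simp
qed

section \<open>First terms, linear growth and gaps of generalized Beatty sequences\<close>

lemma gen_beatty_golden_values:
  "gen_beatty golden_ratio p q r 1 = p + q + r"
  "gen_beatty golden_ratio p q r 2 = 3 * p + 2 * q + r"
  "gen_beatty golden_ratio p q r 3 = 4 * p + 3 * q + r"
proof -
  have "\<lfloor>golden_ratio\<rfloor> = 1" "\<lfloor>2 * golden_ratio\<rfloor> = 3" "\<lfloor>3 * golden_ratio\<rfloor> = 4"
    using golden_ratio_bounds by (simp_all add: floor_eq_iff)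
  then show "gen_beatty golden_ratio p q r 1 = p + q + r"
    "gen_beatty golden_ratio p q r 2 = 3 * p + 2 * q + r"
    "gen_beatty golden_ratio p q r 3 = 4 * p + 3 * q + r"
    by (simp_all add: gen_beatty_def)
qed

text \<open>The deviation from the line is \<open>r\<close> minus \<open>p\<close> times a
  fractional part, which lies in [0, 1).\<close>

lemma gen_beatty_linear:
  "\<bar>of_int (gen_beatty \<alpha> p q r n) - (of_int p * \<alpha> + of_int q) * real n\<bar> \<le> of_int (\<bar>p\<bar> + \<bar>r\<bar>)"
proof -
  have "of_int (gen_beatty \<alpha> p q r n) - (of_int p * \<alpha> + of_int q) * real n
      = of_int r - of_int p * frac (real n * \<alpha>)"
    by (simp add: gen_beatty_def frac_def algebra_simps)
  also have "\<bar>\<dots>\<bar> \<le> \<bar>of_int r\<bar> + \<bar>of_int p\<bar> * frac (real n * \<alpha>)"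
    using abs_triangle_ineq4[of "of_int r" "of_int p * frac (real n * \<alpha>)"] by (simp add: abs_mult)
  also have "\<dots> \<le> \<bar>of_int r\<bar> + \<bar>of_int p\<bar> * 1"
    using frac_lt_1[of "real n * \<alpha>"] by (intro add_left_mono mult_left_mono) auto
  finally show ?thesis by simp
qed

text \<open>The floors of \<phi>, 2 \<phi>, 3 \<phi> are 1, 3, 4, so the first three terms already
  show both possible gaps, \<open>2 * p + q\<close> and then \<open>p + q\<close>.\<close>

lemma gen_beatty_golden_gaps:
  assumes "strict_mono_on {1..} (gen_beatty golden_ratio p q r)"
  shows "p + q \<ge> 1" "2 * p + q \<ge> 1"
  using strict_mono_onD[OF assms, of 1 2] strict_mono_onD[OF assms, of 2 3]
  by (simp_all add: gen_beatty_golden_values del: One_nat_def)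

text \<open>The slope is the mean of the two gaps with the positive weights \<phi> - 1 and 2 -
  \<phi>.\<close>

lemma golden_lin_pos:
  fixes p q :: int
  assumes "p + q \<ge> 1" "2 * p + q \<ge> 1"
  shows "of_int p * golden_ratio + of_int q > 0"
proof -
  have "0 < (golden_ratio - 1) * of_int (2 * p + q) + (2 - golden_ratio) * of_int (p + q)"
    using assms golden_ratio_bounds by (intro add_pos_pos mult_pos_pos) auto
  also have "\<dots> = of_int p * golden_ratio + of_int q" by (simp add: algebra_simps)
  finally show ?thesis .
qed

section \<open>The Diophantine system\<close>

(* A, C are the short and B, D the long gaps of V, W, each diminished by 1; the two hypotheses are the
   coefficients of (x - 1) (y - 1) = 1. *)
lemma gap_equations:
  fixes A B C D :: int
  assumes nonneg: "A \<ge> 0" "B \<ge> 0" "C \<ge> 0" "D \<ge> 0" and "A \<noteq> B"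
    and eq1: "B * D + A * C = 2" and eq2: "B * C + A * D = 1 + A * C"
  shows "(A, B, C, D) \<in> {(0, 1, 1, 2), (1, 2, 0, 1), (1, 0, 2, 3), (2, 3, 1, 0)}"
proof -
  have "B * D \<ge> 0" "A * C \<ge> 0" using nonneg by simp_all
  with eq1 consider "B * D = 2" "A * C = 0" | "B * D = 1" "A * C = 1" | "B * D = 0" "A * C = 2"
    by linarith
  then show ?thesis
  proof cases
    case 1
    then consider "A = 0" | "C = 0" by auto
    then show ?thesis
    proof cases
      assume "A = 0"
      with eq2 have "B * C = 1" by simp
      with nonneg have "B = 1" "C = 1" by (auto simp: zmult_eq_1_iff)
      then show ?thesis using 1 \<open>A = 0\<close> by simp
    next
      assume "C = 0"
      with eq2 have "A * D = 1" by simp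
      with nonneg have "A = 1" "D = 1" by (auto simp: zmult_eq_1_iff)
      then show ?thesis using 1 \<open>C = 0\<close> by simp
    qed
  next
    \<comment> \<open>Here all four unknowns are 1: both slopes equal 2, as for trivial solutions.
      \<open>A \<noteq> B\<close>, which stands for \<open>p \<noteq> 0\<close>, rules this
      out.\<close>
    case 2
    with nonneg have "A = 1" "B = 1" by (auto simp: zmult_eq_1_iff)
    then show ?thesis using \<open>A \<noteq> B\<close> by simp
  next
    case 3
    then consider "B = 0" | "D = 0" by auto
    then show ?thesis
    proof cases
      assume "B = 0"
      then have "A * (D - C) = 1" using 3 eq2 by (simp add: algebra_simps)
      then have "A = 1" using nonneg by (auto simp: zmult_eq_1_iff)
      then show ?thesis using 3 \<open>B = 0\<close> eq2 by simp
    next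
      assume "D = 0"
      then have "C * (B - A) = 1" using 3 eq2 by (simp add: algebra_simps)
      then have "C = 1" using nonneg by (auto simp: zmult_eq_1_iff)
      then show ?thesis using 3 \<open>D = 0\<close> eq2 by simp
    qed
  qed
qed

text \<open>By linear independence of 1 and \<phi>, \<open>x * y = x + y\<close> splits into two
  integer equations, which \<open>gap_equations\<close> solves. The second and fourth tuples are the
  first and third with the sequences swapped.\<close>

lemma increasing_solution_slopes:
  assumes sol: "increasing_solution golden_ratio (p, q, r, s, t, u)" and "p \<noteq> 0"
  shows "(p, q, s, t) \<in> {(1, 0, 1, 1), (1, 1, 1, 0), (- 1, 3, 1, 2), (1, 2, - 1, 3)}"
proof -
  let ?V = "gen_beatty golden_ratio p q r" and ?W = "gen_beatty golden_ratio s t u"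
  have comp: "complementary ?V ?W"
    and mono: "strict_mono_on {1..} ?V" "strict_mono_on {1..} ?W"
    using sol by (auto simp: increasing_solution_def comp_pair_solution_def)
  note gaps = gen_beatty_golden_gaps[OF mono(1)] gen_beatty_golden_gaps[OF mono(2)]
  define x y where "x = of_int p * golden_ratio + of_int q"
    and "y = of_int s * golden_ratio + of_int t"
  have pos: "x > 0" "y > 0"
    using golden_lin_pos gaps by (auto simp: x_def y_def)
  have "1 / x + 1 / y = 1"
    using complementary_growth_rates[OF comp mono pos] gen_beatty_linear
    unfolding x_def y_def by blast
  then have xy: "x * y = x + y" using pos by (simp add: field_simps)
  \<comment> \<open>The left side is \<open>x * y - x - y\<close> with \<phi>^2 replaced by \<phi> +
    1.\<close>
  have "of_int (p * s + p * t + q * s - p - s) * golden_ratio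
      + of_int (p * s + q * t - q - t)
      = x * y - x - y - of_int p * of_int s * (golden_ratio * golden_ratio - golden_ratio - 1)"
    by (simp add: x_def y_def algebra_simps)
  also have "\<dots> = 0" unfolding xy golden_ratio_sq by simp
  finally have "of_int (p * s + p * t + q * s - p - s) * golden_ratio
      + of_int (p * s + q * t - q - t) = 0" .
  from golden_lin_eq_0[OF this]
  have e: "p * s + p * t + q * s = p + s" "p * s + q * t = q + t" by linarith+
  have "(p + q - 1, 2 * p + q - 1, s + t - 1, 2 * s + t - 1)
      \<in> {(0, 1, 1, 2), (1, 2, 0, 1), (1, 0, 2, 3), (2, 3, 1, 0)}"
  proof (rule gap_equations)
    \<comment> \<open>Written in the gaps minus one, twice the constant equation plus three times
      the \<phi> equation gives this identity; the constant equation plus twice the \<phi> equation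
      gives the next.\<close>
    show "(2 * p + q - 1) * (2 * s + t - 1) + (p + q - 1) * (s + t - 1) = 2"
      using e by algebra
    show "(2 * p + q - 1) * (s + t - 1) + (p + q - 1) * (2 * s + t - 1)
        = 1 + (p + q - 1) * (s + t - 1)"
      using e by algebra
  qed (use gaps \<open>p \<noteq> 0\<close> in auto)
  then have "p = 1 \<and> q = 0 \<and> s = 1 \<and> t = 1 \<or> p = 1 \<and> q = 1 \<and> s = 1 \<and> t = 0
    \<or> p = - 1 \<and> q = 3 \<and> s = 1 \<and> t = 2 \<or> p = 1 \<and> q = 2 \<and> s = - 1 \<and> t = 3"
    unfolding insert_iff empty_iff prod.inject by presburger
  then show ?thesis by auto
qed

section \<open>Classification\<close>

text \<open>The slopes leave four cases, and V(1) = 1 fixes \<open>r\<close>. In each case, the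
  smallest integer missing from V must be the first term of W; this fixes \<open>u\<close> or
  produces a collision.\<close>

lemma increasing_solution_golden_cases:
  assumes sol: "increasing_solution golden_ratio (p, q, r, s, t, u)"
    and "p \<noteq> 0" and V1: "gen_beatty golden_ratio p q r 1 = 1"
  shows "(p, q, r, s, t, u) \<in> {(1, 0, 0, 1, 1, 0), (- 1, 3, - 1, 1, 2, 0)}"
proof -
  let ?V = "gen_beatty golden_ratio p q r" and ?W = "gen_beatty golden_ratio s t u"
  have un: "?V ` {1..} \<union> ?W ` {1..} = {k. k > 0}" and dis: "?V ` {1..} \<inter> ?W ` {1..} = {}"
    and mono: "strict_mono_on {1..} ?V" "strict_mono_on {1..} ?W"
    using sol by (auto simp: increasing_solution_def comp_pair_solution_def complementary_def)
  have neq: "?V m \<noteq> ?W n" if "m \<ge> 1" "n \<ge> 1" for m n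
    using dis that by (auto simp: disjoint_iff)
  have W1pos: "?W 1 > 0" using un by (auto simp: set_eq_iff)
  have step: "f n = f 1 \<or> f n = f 2 \<or> f n \<ge> f 3"
    if f: "strict_mono_on {1..} f" and n: "n \<ge> 1" for f :: "nat \<Rightarrow> int" and n
  proof -
    consider "n = 1" | "n = 2" | "n = 3" | "n > 3" using n by linarith
    then show ?thesis using strict_mono_onD[OF f, of 3 n] by cases auto
  qed
  have val: "k = ?V 1 \<or> k = ?V 2 \<or> k = ?W 1 \<or> k = ?W 2 \<or> k \<ge> ?V 3 \<or> k \<ge> ?W 3" if "k > 0" for k
  proof -
    have "k \<in> ?V ` {1..} \<union> ?W ` {1..}" unfolding un using that by simp
    then show ?thesis using step[OF mono(1)] step[OF mono(2)] by blast
  qed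
  have "?V 1 \<noteq> ?W 1" "?V 2 \<noteq> ?W 1" "?V 2 \<noteq> ?W 2" "?V 2 \<noteq> ?W 3"
    using neq by simp_all
  note W = this[unfolded gen_beatty_golden_values] W1pos[unfolded gen_beatty_golden_values]
  note val = val[unfolded gen_beatty_golden_values]
  have r: "r = 1 - p - q" using V1[unfolded gen_beatty_golden_values] by simp
  consider "p = 1" "q = 0" "s = 1" "t = 1" | "p = 1" "q = 1" "s = 1" "t = 0"
    | "p = - 1" "q = 3" "s = 1" "t = 2" | "p = 1" "q = 2" "s = - 1" "t = 3"
    using increasing_solution_slopes[OF sol \<open>p \<noteq> 0\<close>] by auto
  then show ?thesis
  proof cases
    case 1
    \<comment> \<open>V starts 1, 3, 4, so 2 must be W(1) = 2 + u.\<close>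
    have "u = 0" using W val[of 2] unfolding r 1 by linarith
    with 1 r show ?thesis by simp
  next
    case 2
    \<comment> \<open>Here 2 = W(1) gives \<open>u = 1\<close>, and then V(2) = W(2) = 4.\<close>
    have False using W val[of 2] unfolding r 2 by linarith
    then show ?thesis ..
  next
    case 3
    \<comment> \<open>V starts 1, 2, 4, so 3 must be W(1) = 3 + u.\<close>
    have "u = 0" using W val[of 3] unfolding r 3 by linarith
    with 3 r show ?thesis by simp
  next
    case 4
    \<comment> \<open>Here 2 = W(1) gives \<open>u = 0\<close>, and then V(2) = W(3) = 5.\<close>
    have False using W val[of 2] unfolding r 4 by linarith
    then show ?thesis ..
  qed
qed

section \<open>Both pairs are solutions\<close>

lemma increasing_solution_cong:
  assumes "\<And>n. n \<ge> 1 \<Longrightarrow> gen_beatty \<alpha> p q r n = V n" "\<And>n. n \<ge> 1 \<Longrightarrow> gen_beatty \<alpha> s t u n = W n"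
    and "complementary V W" "strict_mono_on {1..} V" "strict_mono_on {1..} W"
  shows "increasing_solution \<alpha> (p, q, r, s, t, u)"
proof -
  have "gen_beatty \<alpha> p q r ` {1..} = V ` {1..}" "gen_beatty \<alpha> s t u ` {1..} = W ` {1..}"
    "inj_on (gen_beatty \<alpha> p q r) {1..} = inj_on V {1..}"
    "inj_on (gen_beatty \<alpha> s t u) {1..} = inj_on W {1..}"
    using assms(1,2) by (auto intro!: image_cong inj_on_cong)
  moreover have "strict_mono_on {1..} (gen_beatty \<alpha> p q r)" "strict_mono_on {1..} (gen_beatty \<alpha> s t u)"
    using assms by (auto simp: strict_mono_on_def)
  ultimately show ?thesis
    using assms(3) by (simp add: increasing_solution_def comp_pair_solution_def complementary_def)
qed

text \<open>The Wythoff pair: its slopes are \<phi> and \<phi> + 1 = \<phi>^2.\<close>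

lemma first_solution: "increasing_solution golden_ratio (1, 0, 0, 1, 1, 0)"
proof (rule increasing_solution_cong)
  let ?b = "golden_ratio + 1"
  have irr: "?b \<notin> \<rat>"
    using golden_ratio_irrational Rats_diff[of ?b 1] by auto
  have sum: "1 / golden_ratio + 1 / ?b = 1"
    using golden_ratio_bounds golden_ratio_sq by (simp add: field_simps)
  have pos: "golden_ratio > 0" "?b > 0" using golden_ratio_bounds by simp_all
  note * = beatty_complementary[OF pos sum golden_ratio_irrational irr]
  show "complementary (\<lambda>n. \<lfloor>real n * golden_ratio\<rfloor>) (\<lambda>n. \<lfloor>real n * ?b\<rfloor>)"
    "strict_mono_on {1..} (\<lambda>n. \<lfloor>real n * golden_ratio\<rfloor>)"
    "strict_mono_on {1..} (\<lambda>n. \<lfloor>real n * ?b\<rfloor>)"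
    by (fact *)+
  fix n :: nat
  show "gen_beatty golden_ratio 1 0 0 n = \<lfloor>real n * golden_ratio\<rfloor>"
    by (simp add: gen_beatty_def)
  have "real n * ?b = real n * golden_ratio + of_int (int n)" by (simp add: algebra_simps)
  then show "gen_beatty golden_ratio 1 1 0 n = \<lfloor>real n * ?b\<rfloor>"
    by (simp only: gen_beatty_def floor_add_int [symmetric])
qed

text \<open>The slopes 3 - \<phi> and \<phi> + 2 have sum 5 and product 5, so their reciprocals add
  up to 1.\<close>

lemma second_solution: "increasing_solution golden_ratio (- 1, 3, - 1, 1, 2, 0)"
proof (rule increasing_solution_cong)
  let ?a = "3 - golden_ratio" and ?b = "golden_ratio + 2"
  have irr: "?a \<notin> \<rat>" "?b \<notin> \<rat>"
    using golden_ratio_irrational Rats_diff[of 3 ?a] Rats_diff[of ?b 2] by auto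
  have pos: "?a > 0" "?b > 0" using golden_ratio_bounds by simp_all
  then have sum: "1 / ?a + 1 / ?b = 1"
    using golden_ratio_sq by (simp add: field_simps)
  note * = beatty_complementary[OF pos sum irr]
  show "complementary (\<lambda>n. \<lfloor>real n * ?a\<rfloor>) (\<lambda>n. \<lfloor>real n * ?b\<rfloor>)"
    "strict_mono_on {1..} (\<lambda>n. \<lfloor>real n * ?a\<rfloor>)"
    "strict_mono_on {1..} (\<lambda>n. \<lfloor>real n * ?b\<rfloor>)"
    by (fact *)+
  fix n :: nat
  have "real n * ?b = real n * golden_ratio + of_int (2 * int n)" by (simp add: algebra_simps)
  then show "gen_beatty golden_ratio 1 2 0 n = \<lfloor>real n * ?b\<rfloor>"
    by (simp only: gen_beatty_def floor_add_int [symmetric])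
  \<comment> \<open>The offset -1 arises because the floor of -z is one less than minus the floor of
    z for irrational z. At index 0 the two sides differ, being -1 and 0.\<close>
  assume "n \<ge> 1"
  then have "real n * golden_ratio \<notin> \<rat>"
    using golden_ratio_irrational Rats_divide[of "real n * golden_ratio" "real n"] by auto
  from floor_eq_iff_irrational[OF this, of "\<lfloor>real n * golden_ratio\<rfloor>"]
  have "\<lfloor>real n * ?a\<rfloor> = 3 * int n - \<lfloor>real n * golden_ratio\<rfloor> - 1"
    by (intro floor_unique) (simp_all add: algebra_simps)
  then show "gen_beatty golden_ratio (- 1) 3 (- 1) n = \<lfloor>real n * ?a\<rfloor>"
    by (simp add: gen_beatty_def)
qed

theorem theorem11:
  "{(p, q, r, s, t, u).
      increasing_solution golden_ratio (p, q, r, s, t, u) \<and>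
      \<not> trivial_solution (p, q, r, s, t, u) \<and>
      gen_beatty golden_ratio p q r 1 = 1}
   = {(1, 0, 0, 1, 1, 0), (- 1, 3, - 1, 1, 2, 0)}"
proof -
  have "increasing_solution golden_ratio (p, q, r, s, t, u) \<and>
      \<not> trivial_solution (p, q, r, s, t, u) \<and> gen_beatty golden_ratio p q r 1 = 1
    \<longleftrightarrow> (p, q, r, s, t, u) \<in> {(1, 0, 0, 1, 1, 0), (- 1, 3, - 1, 1, 2, 0)}" for p q r s t u
    using increasing_solution_golden_cases[of p q r s t u] first_solution second_solution
    by (auto simp: trivial_solution_def gen_beatty_golden_values simp del: One_nat_def)
  then show ?thesis by auto
qed

end
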